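(* Let $n\ge0$ and $0\le d\le n$. Then $\{u_\alpha:\alpha\in I_d(n)\}$ is a set of representatives of the cosets of $\mathcal{O}_{n-d}^*/\mathcal{O}_n^*$.
   Context: $K$ is a nonarchimedean local field of characteristic zero, ring of integers $\mathcal{O}_K$, uniformizer $p$; $L$ is a reduced 2-dimensional $K$-algebra (unramified or ramified quadratic field extension, or $K\times K$); $\mathcal{O}_L=\mathcal{O}_K[\Delta]$ is the integral closure of $\mathcal{O}_K$ in $L$, and $\mathcal{O}_n=\mathcal{O}_K[p^n\Delta]$ with unit group $\mathcal{O}_n^*$. Fix a set $R(p)\subset\mathcal{O}_K$ of representatives of $\mathcal{O}_K/p\mathcal{O}_K$. For $i\ge1$ and $t\in R(p)$ put $u^{(i)}_t=1+tp^i\Delta$. Let $R_0(p)=\{0,1,\dots,[\mathcal{O}_0^*:\mathcal{O}_1^*]-1\}$ and let $\{u^{(0)}_t: t\in R_0(p)\}$ be a fixed set of representatives of $\mathcal{O}_0^*/\mathcal{O}_1^*$. For $0\le d\le n$, $I_d(n)$ is the set of tuples $\alpha=(\alpha_{n-d},\dots,\alpha_{n-1})$ with $\alpha_i\in R(p)$ for $i\ge1$ and $\alpha_0\in R_0(p)$ (for $d=0$ it consists of the empty tuple), and $u_\alpha=u^{(n-d)}_{\alpha_{n-d}}u^{(n-d+1)}_{\alpha_{n-d+1}}\cdots u^{(n-1)}_{\alpha_{n-1}}$ (empty product $=1$). *)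

theory Defs
  imports Complex_Main "HOL-Library.FuncSet" "HOL-Algebra.Coset"
    "HOL-Computational_Algebra.Polynomial"
begin

text \<open>A discrete valuation is an integer-valued function whose value at 0 is irrelevant;
  \<open>val_ge v k x\<close> says that the valuation of \<open>x\<close> is at least \<open>k\<close>, where 0 has infinite valuation.\<close>

definition val_ge :: "('k::field \<Rightarrow> int) \<Rightarrow> int \<Rightarrow> 'k \<Rightarrow> bool" where
  "val_ge v k x \<longleftrightarrow> x = 0 \<or> k \<le> v x"

definition val_ring :: "('k::field \<Rightarrow> int) \<Rightarrow> 'k set" where
  "val_ring v = {x. val_ge v 0 x}"

definition val_ideal :: "('k::field \<Rightarrow> int) \<Rightarrow> 'k set" where
  "val_ideal v = {x. val_ge v 1 x}"

definition uniformizer :: "('k::field \<Rightarrow> int) \<Rightarrow> 'k \<Rightarrow> bool" where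
  "uniformizer v p \<longleftrightarrow> p \<noteq> 0 \<and> v p = 1"

definition additive_group :: "'a::ab_group_add set \<Rightarrow> 'a monoid" where
  "additive_group S = \<lparr>carrier = S, monoid.mult = (+), monoid.one = 0\<rparr>"

definition mult_monoid :: "'a::comm_ring_1 set \<Rightarrow> 'a monoid" where
  "mult_monoid S = \<lparr>carrier = S, monoid.mult = (*), monoid.one = 1\<rparr>"

text \<open>For a nonarchimedean local field of characteristic zero, the normalized valuation \<open>v\<close> is
  complete with finite residue field; the characteristic is fixed by the type class.\<close>

locale nonarch_local_field_char_0 =
  fixes v :: "'k::field_char_0 \<Rightarrow> int"
  assumes val_mult: "\<And>x y. x \<noteq> 0 \<Longrightarrow> y \<noteq> 0 \<Longrightarrow> v (x * y) = v x + v y"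
    and val_add: "\<And>x y. x \<noteq> 0 \<Longrightarrow> y \<noteq> 0 \<Longrightarrow> x + y \<noteq> 0 \<Longrightarrow> min (v x) (v y) \<le> v (x + y)"
    and val_normalized: "\<exists>p. uniformizer v p"
    and val_complete: "\<And>s :: nat \<Rightarrow> 'k.
      (\<forall>k. \<exists>N. \<forall>i\<ge>N. \<forall>j\<ge>N. val_ge v k (s i - s j)) \<Longrightarrow>
      (\<exists>l. \<forall>k. \<exists>N. \<forall>i\<ge>N. val_ge v k (s i - l))"
    and residue_finite: "finite (rcosets\<^bsub>additive_group (val_ring v)\<^esub> (val_ideal v))"

locale reduced_quadratic_algebra = vector_space scale
  for scale :: "'k::field \<Rightarrow> 'l::comm_ring_1 \<Rightarrow> 'l" +
  assumes scale_mult: "\<And>a x y. scale a x * y = scale a (x * y)"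
    and dim_two: "dim (UNIV :: 'l set) = 2"
    and reduced: "\<And>(x :: 'l) m :: nat. x ^ m = 0 \<Longrightarrow> x = 0"

definition alg_eval :: "('k::field \<Rightarrow> 'l::comm_ring_1 \<Rightarrow> 'l) \<Rightarrow> 'k poly \<Rightarrow> 'l \<Rightarrow> 'l" where
  "alg_eval scale f x = (\<Sum>i\<le>degree f. scale (coeff f i) (x ^ i))"

definition adjoin :: "('k::field \<Rightarrow> 'l::comm_ring_1 \<Rightarrow> 'l) \<Rightarrow> 'k set \<Rightarrow> 'l \<Rightarrow> 'l set" where
  "adjoin scale A x = {alg_eval scale f x | f. \<forall>i. coeff f i \<in> A}"

definition integral_closure :: "('k::field \<Rightarrow> 'l::comm_ring_1 \<Rightarrow> 'l) \<Rightarrow> 'k set \<Rightarrow> 'l set" where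
  "integral_closure scale A =
    {x. \<exists>f. lead_coeff f = 1 \<and> (\<forall>i. coeff f i \<in> A) \<and> alg_eval scale f x = 0}"

definition quad_order ::
    "('k::field \<Rightarrow> int) \<Rightarrow> ('k \<Rightarrow> 'l::comm_ring_1 \<Rightarrow> 'l) \<Rightarrow> 'k \<Rightarrow> 'l \<Rightarrow> nat \<Rightarrow> 'l set" where
  "quad_order v scale p \<Delta> n = adjoin scale (val_ring v) (scale (p ^ n) \<Delta>)"

definition unit_cosets :: "'l::comm_ring_1 set \<Rightarrow> 'l set \<Rightarrow> 'l set set" where
  "unit_cosets A B = rcosets\<^bsub>units_of (mult_monoid A)\<^esub> (Units (mult_monoid B))"

text \<open>Representatives are an indexed family: distinct indices represent distinct cosets.\<close>

definition represents :: "('i \<Rightarrow> 'a) \<Rightarrow> 'i set \<Rightarrow> 'a set set \<Rightarrow> bool" where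
  "represents f I C \<longleftrightarrow> f ` I \<subseteq> \<Union>C \<and> (\<forall>c\<in>C. \<exists>!i. i \<in> I \<and> f i \<in> c)"

definition R0 ::
    "('k::field \<Rightarrow> int) \<Rightarrow> ('k \<Rightarrow> 'l::comm_ring_1 \<Rightarrow> 'l) \<Rightarrow> 'k \<Rightarrow> 'l \<Rightarrow> nat set" where
  "R0 v scale p \<Delta> =
    {..<card (unit_cosets (quad_order v scale p \<Delta> 0) (quad_order v scale p \<Delta> 1))}"

text \<open>The entry of a tuple at position 0 is a natural number, all others lie in the field;
  hence the sum type. The tuples are indexed by the positions \<open>n - d, \<dots>, n - 1\<close>.\<close>

definition index_tuples :: "nat set \<Rightarrow> 'k set \<Rightarrow> nat \<Rightarrow> nat \<Rightarrow> (nat \<Rightarrow> nat + 'k) set" where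
  "index_tuples Z R d n = (\<Pi>\<^sub>E i\<in>{n - d..<n}. if i = 0 then Inl ` Z else Inr ` R)"

definition u_factor :: "('k::field \<Rightarrow> 'l::comm_ring_1 \<Rightarrow> 'l) \<Rightarrow> 'k \<Rightarrow> 'l \<Rightarrow> (nat \<Rightarrow> 'l) \<Rightarrow>
    nat \<Rightarrow> nat + 'k \<Rightarrow> 'l" where
  "u_factor scale p \<Delta> u0 i a =
    (case a of Inl t \<Rightarrow> u0 t | Inr t \<Rightarrow> 1 + scale (t * p ^ i) \<Delta>)"

definition u_tuple :: "('k::field \<Rightarrow> 'l::comm_ring_1 \<Rightarrow> 'l) \<Rightarrow> 'k \<Rightarrow> 'l \<Rightarrow> (nat \<Rightarrow> 'l) \<Rightarrow>
    nat \<Rightarrow> nat \<Rightarrow> (nat \<Rightarrow> nat + 'k) \<Rightarrow> 'l" where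
  "u_tuple scale p \<Delta> u0 d n \<alpha> = (\<Prod>i\<in>{n - d..<n}. u_factor scale p \<Delta> u0 i (\<alpha> i))"

end

theory Submission
  imports Defs
begin

text \<open>
  Representatives multiply along a chain of subgroups of an abelian group, so only the
  consecutive quotients \<open>\<O>\<^sub>i\<^sup>* / \<O>\<^sub>i\<^sub>+\<^sub>1\<^sup>*\<close> with \<open>i \<ge> 1\<close> matter.
  By Gauss's lemma \<open>\<Delta>\<^sup>2 = a\<Delta> + b\<close> with integral \<open>a, b\<close>, hence
  \<open>\<O>\<^sub>i = \<O>\<^sub>K + p\<^sup>i\<Delta>\<O>\<^sub>K\<close>, and for \<open>i \<ge> 1\<close> an element \<open>c + ep\<^sup>i\<Delta>\<close> is a unit iff \<open>c\<close> is.
  If \<open>x\<^sup>-\<^sup>1 = c + ep\<^sup>i\<Delta>\<close>, then \<open>(1 + tp\<^sup>i\<Delta>) x\<^sup>-\<^sup>1\<close> has \<open>\<Delta>\<close>-coordinate congruent to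
  \<open>(tc + e)p\<^sup>i\<close> modulo \<open>p\<^sup>i\<^sup>+\<^sup>1\<close>, so it lies in \<open>\<O>\<^sub>i\<^sub>+\<^sub>1\<^sup>*\<close> exactly for the one residue
  class \<open>t \<equiv> -e/c\<close> modulo \<open>p\<close>.
\<close>

section \<open>Representatives along a chain of unit groups\<close>

text \<open>Used in the final theorem to strip the tags \<open>Inl\<close> and \<open>Inr\<close>
  from the indices; injectivity keeps the index of a coset unique.\<close>

lemma represents_image_iff:
  assumes "inj_on h I"
  shows "represents f (h ` I) C \<longleftrightarrow> represents (\<lambda>i. f (h i)) I C"
proof -
  have "(\<exists>!j. j \<in> h ` I \<and> f j \<in> c) \<longleftrightarrow> (\<exists>!i. i \<in> I \<and> f (h i) \<in> c)" for c
    using assms unfolding Ex1_def inj_on_def by blast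
  then show ?thesis
    by (simp add: represents_def image_image)
qed

section \<open>Unit groups of multiplicative submonoids and their cosets\<close>

lemma Units_mult_monoid: "Units (mult_monoid A) = {x \<in> A. \<exists>y\<in>A. x * y = 1}"
  by (auto simp: Units_def mult_monoid_def mult.commute)

lemma monoid_mult_monoid_iff:
  "monoid (mult_monoid A) \<longleftrightarrow> 1 \<in> A \<and> (\<forall>x\<in>A. \<forall>y\<in>A. x * y \<in> A)"
  by (auto simp: monoid_def mult_monoid_def mult.assoc)

lemma Units_mult_monoid_mono: "B \<subseteq> A \<Longrightarrow> Units (mult_monoid B) \<subseteq> Units (mult_monoid A)"
  by (auto simp: Units_mult_monoid)

lemma one_in_Units_mult_monoid: "monoid (mult_monoid A) \<Longrightarrow> 1 \<in> Units (mult_monoid A)"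
  by (force simp: Units_mult_monoid monoid_mult_monoid_iff)

lemma mult_in_Units_mult_monoid:
  assumes "monoid (mult_monoid A)" "x \<in> Units (mult_monoid A)" "y \<in> Units (mult_monoid A)"
  shows "x * y \<in> Units (mult_monoid A)"
  using monoid.Units_m_closed[OF assms] by (simp add: mult_monoid_def)

lemma Units_mult_monoid_inverseE:
  assumes "x \<in> Units (mult_monoid A)"
  obtains y where "y \<in> Units (mult_monoid A)" "x * y = 1"
  using assms by (auto simp: Units_mult_monoid mult.commute)

text \<open>Turns cosets into equations once and for all. The cosets cover exactly the units of
  \<open>A\<close>, because \<open>1\<close> is a unit of \<open>B\<close> and units of
  \<open>B\<close> are units of \<open>A\<close>.\<close>

lemma represents_unit_cosets_iff:
  assumes A: "monoid (mult_monoid A)" and B: "monoid (mult_monoid B)" and "B \<subseteq> A"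
  shows "represents f I (unit_cosets A B) \<longleftrightarrow>
    f ` I \<subseteq> Units (mult_monoid A) \<and>
    (\<forall>x\<in>Units (mult_monoid A). \<exists>!i. i \<in> I \<and> (\<exists>h\<in>Units (mult_monoid B). f i = h * x))"
proof -
  have cosets: "unit_cosets A B =
      (\<lambda>x. {h * x | h. h \<in> Units (mult_monoid B)}) ` Units (mult_monoid A)"
    by (auto simp: unit_cosets_def RCOSETS_def r_coset_def units_of_def mult_monoid_def)
  have "{h * x | h. h \<in> Units (mult_monoid B)} \<subseteq> Units (mult_monoid A)"
    if "x \<in> Units (mult_monoid A)" for x
    using that mult_in_Units_mult_monoid[OF A] Units_mult_monoid_mono[OF \<open>B \<subseteq> A\<close>] by blast
  moreover have "x \<in> {h * x | h. h \<in> Units (mult_monoid B)}" for x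
    using one_in_Units_mult_monoid[OF B] by force
  ultimately have "\<Union> (unit_cosets A B) = Units (mult_monoid A)"
    unfolding cosets by blast
  then show ?thesis
    by (simp add: represents_def cosets Bex_def conj_commute)
qed

text \<open>Induction on \<open>n\<close>: if the product over the first entries is
  \<open>h * x\<close> with \<open>h\<close> a unit of \<open>E n\<close>, the next factor has to
  represent the coset of the inverse of \<open>h\<close>. For uniqueness, the equation modulo the
  units of \<open>E n\<close> fixes the earlier entries, and cancelling them fixes the last
  one.\<close>

lemma represents_unit_cosets_chain:
  fixes E :: "nat \<Rightarrow> 'l::comm_ring_1 set"
  assumes monoid: "\<And>i. monoid (mult_monoid (E i))"
    and anti: "\<And>i j. i \<le> j \<Longrightarrow> E j \<subseteq> E i"
    and step: "\<And>i. m \<le> i \<Longrightarrow> represents (g i) (I i) (unit_cosets (E i) (E (Suc i)))"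
    and "m \<le> n"
  shows "represents (\<lambda>\<alpha>. \<Prod>i\<in>{m..<n}. g i (\<alpha> i)) (\<Pi>\<^sub>E i\<in>{m..<n}. I i)
    (unit_cosets (E m) (E n))"
  using \<open>m \<le> n\<close>
proof (induction n rule: nat_induct_at_least)
  case base
  \<comment> \<open>The only index is the empty tuple, with product 1, and the only coset is the
    whole group; \<open>h\<close> is the inverse of \<open>x\<close>.\<close>
  have "\<exists>h\<in>Units (mult_monoid (E m)). 1 = h * x" if "x \<in> Units (mult_monoid (E m))" for x
    using Units_mult_monoid_inverseE[OF that] by (metis mult.commute)
  then show ?case
    using one_in_Units_mult_monoid[OF monoid]
    by (auto simp: represents_unit_cosets_iff monoid)
next
  case (Suc n)
  let ?U = "\<lambda>i. Units (mult_monoid (E i))"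
  let ?u = "\<lambda>n \<alpha>. \<Prod>i\<in>{m..<n}. g i (\<alpha> i)"
  let ?T = "\<lambda>n. \<Pi>\<^sub>E i\<in>{m..<n}. I i"
  note iff = represents_unit_cosets_iff[OF monoid monoid anti]
  note mult = mult_in_Units_mult_monoid[OF monoid]
  have mono: "?U j \<subseteq> ?U i" if "i \<le> j" for i j
    using anti[OF that] by (rule Units_mult_monoid_mono)
  have IH: "?u n ` ?T n \<subseteq> ?U m"
    "\<And>x. x \<in> ?U m \<Longrightarrow> \<exists>!\<alpha>. \<alpha> \<in> ?T n \<and> (\<exists>h\<in>?U n. ?u n \<alpha> = h * x)"
    using Suc.IH[unfolded iff[OF \<open>m \<le> n\<close>]] by blast+
  have st: "g n ` I n \<subseteq> ?U n"
    "\<And>x. x \<in> ?U n \<Longrightarrow> \<exists>!t. t \<in> I n \<and> (\<exists>h\<in>?U (Suc n). g n t = h * x)"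
    using step[OF \<open>m \<le> n\<close>, unfolded iff[OF le_SucI[OF le_refl]]] by blast+
  have ins: "{m..<Suc n} = insert n {m..<n}"
    using \<open>m \<le> n\<close> by auto
  have u_Suc: "?u (Suc n) \<alpha> = ?u n \<alpha> * g n (\<alpha> n)" for \<alpha>
    unfolding ins by (simp add: mult.commute)
  have u_upd: "?u n (\<alpha>(n := t)) = ?u n \<alpha>" for \<alpha> t
    by (rule prod.cong) auto
  have T_Suc: "\<beta> \<in> ?T (Suc n) \<longleftrightarrow> (\<exists>t\<in>I n. \<exists>\<alpha>\<in>?T n. \<beta> = \<alpha>(n := t))" for \<beta>
    unfolding ins PiE_insert_eq by auto
  show ?case
    unfolding iff[OF le_SucI[OF \<open>m \<le> n\<close>]]
  proof (intro conjI ballI)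
    show "?u (Suc n) ` ?T (Suc n) \<subseteq> ?U m"
    proof (clarify, unfold T_Suc, clarify, unfold u_Suc u_upd fun_upd_same)
      fix t \<alpha> assume "t \<in> I n" "\<alpha> \<in> ?T n"
      then have "?u n \<alpha> \<in> ?U m" "g n t \<in> ?U m"
        using IH(1) st(1) mono[OF \<open>m \<le> n\<close>] by blast+
      then show "?u n \<alpha> * g n t \<in> ?U m"
        by (rule mult)
    qed
  next
    fix x assume x: "x \<in> ?U m"
    obtain x' where x': "x * x' = 1"
      using Units_mult_monoid_inverseE[OF x] by blast
    obtain \<alpha> h where \<alpha>: "\<alpha> \<in> ?T n" "h \<in> ?U n" "?u n \<alpha> = h * x"
      using IH(2)[OF x] by blast
    obtain h' where h': "h' \<in> ?U n" "h * h' = 1"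
      using Units_mult_monoid_inverseE[OF \<alpha>(2)] by blast
    obtain t k where t: "t \<in> I n" "k \<in> ?U (Suc n)" "g n t = k * h'"
      using st(2)[OF h'(1)] by blast
    show "\<exists>!\<beta>. \<beta> \<in> ?T (Suc n) \<and> (\<exists>h\<in>?U (Suc n). ?u (Suc n) \<beta> = h * x)"
    proof (rule ex1I[of _ "\<alpha>(n := t)"])
      have "?u (Suc n) (\<alpha>(n := t)) = (h * h') * (k * x)"
        using \<alpha>(3) t(3) by (simp only: u_Suc u_upd fun_upd_same) (simp add: ac_simps)
      also have "\<dots> = k * x"
        by (simp add: h')
      finally have "?u (Suc n) (\<alpha>(n := t)) = k * x" .
      moreover have "\<alpha>(n := t) \<in> ?T (Suc n)"
        unfolding T_Suc using \<alpha>(1) t(1) by blast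
      ultimately show "\<alpha>(n := t) \<in> ?T (Suc n) \<and>
          (\<exists>h\<in>?U (Suc n). ?u (Suc n) (\<alpha>(n := t)) = h * x)"
        using t(2) by blast
    next
      fix \<beta> assume "\<beta> \<in> ?T (Suc n) \<and> (\<exists>h\<in>?U (Suc n). ?u (Suc n) \<beta> = h * x)"
      then obtain \<gamma> s l where \<beta>: "\<beta> = \<gamma>(n := s)" "s \<in> I n" "\<gamma> \<in> ?T n"
        and l: "l \<in> ?U (Suc n)" "?u (Suc n) \<beta> = l * x"
        unfolding T_Suc by blast
      have eq: "?u n \<gamma> * g n s = l * x"
        using l(2) unfolding \<beta>(1) by (simp only: u_Suc u_upd fun_upd_same)
      have "g n s \<in> ?U n"
        using st(1) \<beta>(2) by blast
      then obtain r where r: "r \<in> ?U n" "g n s * r = 1"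
        by (rule Units_mult_monoid_inverseE)
      \<comment> \<open>Cancelling the last factor, a unit of \<open>E n\<close>, shows that
        \<open>\<gamma>\<close> already represents the coset of \<open>x\<close> modulo the units of
        \<open>E n\<close>.\<close>
      have "?u n \<gamma> = (?u n \<gamma> * g n s) * r"
        using r(2) by (simp add: mult.assoc)
      then have "?u n \<gamma> = (l * r) * x"
        unfolding eq by (simp add: ac_simps)
      moreover have "l * r \<in> ?U n"
        using l(1) r(1) mono[of n "Suc n"] mult by auto
      ultimately have "\<gamma> = \<alpha>"
        using IH(2)[OF x] \<beta>(3) \<alpha> by blast
      \<comment> \<open>Two factors equal to 1 are inserted so that \<open>h * x\<close>, which is
        the product over \<open>\<gamma>\<close>, can be joined with \<open>g n s\<close>.\<close>
      have "g n s = (h * h') * (x * x') * g n s"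
        by (simp add: h' x')
      also have "\<dots> = (h * x * g n s) * (h' * x')"
        by (simp add: ac_simps)
      also have "\<dots> = (l * x) * (h' * x')"
        using eq \<alpha>(3) \<open>\<gamma> = \<alpha>\<close> by simp
      also have "\<dots> = l * h' * (x * x')"
        by (simp add: ac_simps)
      finally have "g n s = l * h'"
        by (simp add: x')
      then have "s = t"
        using st(2)[OF h'(1)] \<beta>(2) l(1) t by blast
      then show "\<beta> = \<alpha>(n := t)"
        using \<beta>(1) \<open>\<gamma> = \<alpha>\<close> by simp
    qed
  qed
qed

section \<open>Discrete valuations and Gauss's lemma\<close>

lemma val_ge_0 [simp]: "val_ge v k 0"
  by (simp add: val_ge_def)

lemma val_ge_mono: "val_ge v k x \<Longrightarrow> j \<le> k \<Longrightarrow> val_ge v j x"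
  by (auto simp: val_ge_def)

context nonarch_local_field_char_0
begin

lemma val_one [simp]: "v 1 = 0"
  using val_mult[of 1 1] by simp

lemma val_uminus [simp]: "v (- x) = v x"
proof (cases "x = 0")
  case False
  have "v (- 1) = 0"
    using val_mult[of "- 1" "- 1"] by simp
  then show ?thesis
    using val_mult[of "- 1" x] False by simp
qed simp

lemma val_inverse: "x \<noteq> 0 \<Longrightarrow> v (inverse x) = - v x"
  using val_mult[of x "inverse x"] by simp

lemma val_ge_add: "val_ge v k x \<Longrightarrow> val_ge v k y \<Longrightarrow> val_ge v k (x + y)"
  using val_add[of x y] by (cases "x = 0 \<or> y = 0 \<or> x + y = 0") (auto simp: val_ge_def)

lemma val_ge_uminus: "val_ge v k x \<Longrightarrow> val_ge v k (- x)"
  by (auto simp: val_ge_def)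

lemma val_ge_diff: "val_ge v k x \<Longrightarrow> val_ge v k y \<Longrightarrow> val_ge v k (x - y)"
  using val_ge_add[of k x "- y"] val_ge_uminus[of k y] by simp

lemma val_ge_mult: "val_ge v j x \<Longrightarrow> val_ge v k y \<Longrightarrow> val_ge v (j + k) (x * y)"
  using val_mult[of x y] by (cases "x = 0 \<or> y = 0") (auto simp: val_ge_def)

lemma val_ge_sum: "(\<And>i. i \<in> S \<Longrightarrow> val_ge v k (f i)) \<Longrightarrow> val_ge v k (sum f S)"
  by (induction S rule: infinite_finite_induct) (auto intro: val_ge_add)

lemma zero_in_val_ring: "0 \<in> val_ring v"
  and one_in_val_ring: "1 \<in> val_ring v"
  and add_in_val_ring: "x \<in> val_ring v \<Longrightarrow> y \<in> val_ring v \<Longrightarrow> x + y \<in> val_ring v"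
  and diff_in_val_ring: "x \<in> val_ring v \<Longrightarrow> y \<in> val_ring v \<Longrightarrow> x - y \<in> val_ring v"
  and uminus_in_val_ring: "x \<in> val_ring v \<Longrightarrow> - x \<in> val_ring v"
  and mult_in_val_ring: "x \<in> val_ring v \<Longrightarrow> y \<in> val_ring v \<Longrightarrow> x * y \<in> val_ring v"
  using val_ge_mult[of 0 x 0 y]
  by (simp_all add: val_ring_def val_ge_add val_ge_uminus val_ge_diff val_ge_def[of _ _ 1])

lemma power_in_val_ring: "x \<in> val_ring v \<Longrightarrow> x ^ n \<in> val_ring v"
  by (induction n) (auto intro: one_in_val_ring mult_in_val_ring)

lemmas val_ring_intros = zero_in_val_ring one_in_val_ring add_in_val_ring diff_in_val_ring
  uminus_in_val_ring mult_in_val_ring power_in_val_ring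

lemma val_ideal_subset: "val_ideal v \<subseteq> val_ring v"
  by (auto simp: val_ideal_def val_ring_def intro: val_ge_mono)

lemma one_notin_val_ideal: "1 \<notin> val_ideal v"
  by (simp add: val_ideal_def val_ge_def)

lemma zero_in_val_ideal: "0 \<in> val_ideal v"
  and add_in_val_ideal: "x \<in> val_ideal v \<Longrightarrow> y \<in> val_ideal v \<Longrightarrow> x + y \<in> val_ideal v"
  and diff_in_val_ideal: "x \<in> val_ideal v \<Longrightarrow> y \<in> val_ideal v \<Longrightarrow> x - y \<in> val_ideal v"
  and mult_in_val_ideal: "x \<in> val_ideal v \<Longrightarrow> y \<in> val_ring v \<Longrightarrow> x * y \<in> val_ideal v"
  using val_ge_mult[of 1 x 0 y]
  by (simp_all add: val_ideal_def val_ring_def val_ge_add val_ge_diff)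

lemma add_in_val_ideal_iff: "y \<in> val_ideal v \<Longrightarrow> x + y \<in> val_ideal v \<longleftrightarrow> x \<in> val_ideal v"
  using add_in_val_ideal[of x y] diff_in_val_ideal[of "x + y" y] by auto

text \<open>The ideal is prime: valuations add and are nonnegative on the ring, so their sum is
  positive exactly if one of them is.\<close>

lemma mult_in_val_ideal_iff:
  assumes "x \<in> val_ring v" "y \<in> val_ring v"
  shows "x * y \<in> val_ideal v \<longleftrightarrow> x \<in> val_ideal v \<or> y \<in> val_ideal v"
  using assms val_mult[of x y]
  by (cases "x = 0 \<or> y = 0") (auto simp: val_ideal_def val_ring_def val_ge_def)

lemma inverse_in_val_ring: "x \<in> val_ring v \<Longrightarrow> x \<notin> val_ideal v \<Longrightarrow> inverse x \<in> val_ring v"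
  by (auto simp: val_ideal_def val_ring_def val_ge_def val_inverse)

text \<open>Prepares Gauss's lemma: taking the last index of minimal valuation makes the inequality
  strict at all later indices.\<close>

lemma last_coeff_of_minimal_val:
  fixes q :: "'k poly"
  assumes "q \<noteq> 0"
  obtains i where "coeff q i \<noteq> 0"
    "\<And>j. val_ge v (v (coeff q i)) (coeff q j)"
    "\<And>j. i < j \<Longrightarrow> val_ge v (v (coeff q i) + 1) (coeff q j)"
proof -
  define S where "S = {i. coeff q i \<noteq> 0}"
  have "finite S"
    by (rule finite_subset[of _ "{..degree q}"]) (auto simp: S_def le_degree)
  have "degree q \<in> S"
    using assms by (simp add: S_def)
  define \<mu> where "\<mu> = Min ((\<lambda>i. v (coeff q i)) ` S)"
  have \<mu>_le: "\<mu> \<le> v (coeff q j)" if "j \<in> S" for j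
    using that \<open>finite S\<close> by (simp add: \<mu>_def)
  define T where "T = {i \<in> S. v (coeff q i) = \<mu>}"
  have "\<mu> \<in> (\<lambda>i. v (coeff q i)) ` S"
    unfolding \<mu>_def using \<open>finite S\<close> \<open>degree q \<in> S\<close> by (intro Min_in) auto
  then have "T \<noteq> {}" "finite T"
    using \<open>finite S\<close> by (auto simp: T_def)
  then have M: "Max T \<in> T" "\<And>j. j \<in> T \<Longrightarrow> j \<le> Max T"
    by auto
  show thesis
  proof (rule that[of "Max T"])
    show "coeff q (Max T) \<noteq> 0"
      using M(1) by (auto simp: T_def S_def)
    show "val_ge v (v (coeff q (Max T))) (coeff q j)" for j
      using M(1) \<mu>_le[of j] by (auto simp: T_def S_def val_ge_def)
    show "val_ge v (v (coeff q (Max T)) + 1) (coeff q j)" if "Max T < j" for j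
    proof -
      have "j \<notin> T"
        using M(2)[of j] that by auto
      then show ?thesis
        using M(1) \<mu>_le[of j] by (force simp: T_def S_def val_ge_def)
    qed
  qed
qed

text \<open>Gauss's lemma for monic factors. In the coefficient of \<open>q * g\<close> at
  \<open>i0 + j0\<close> a single term attains the valuation \<open>\<mu> + \<nu>\<close>, so
  integrality forces this sum to be nonnegative, while both minima are at most 0.\<close>

lemma monic_factor_coeff_in_val_ring:
  fixes q g :: "'k poly"
  assumes "lead_coeff q = 1" "lead_coeff g = 1" and int: "\<And>i. coeff (q * g) i \<in> val_ring v"
  shows "coeff g i \<in> val_ring v"
proof -
  have "q \<noteq> 0" "g \<noteq> 0"
    using assms(1,2) by auto
  obtain i0 where i0: "coeff q i0 \<noteq> 0" "\<And>j. val_ge v (v (coeff q i0)) (coeff q j)"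
    "\<And>j. i0 < j \<Longrightarrow> val_ge v (v (coeff q i0) + 1) (coeff q j)"
    using last_coeff_of_minimal_val[of q] \<open>q \<noteq> 0\<close> by metis
  obtain j0 where j0: "coeff g j0 \<noteq> 0" "\<And>j. val_ge v (v (coeff g j0)) (coeff g j)"
    "\<And>j. j0 < j \<Longrightarrow> val_ge v (v (coeff g j0) + 1) (coeff g j)"
    using last_coeff_of_minimal_val[of g] \<open>g \<noteq> 0\<close> by metis
  define \<mu> \<nu> where "\<mu> = v (coeff q i0)" and "\<nu> = v (coeff g j0)"
  \<comment> \<open>The leading coefficients are 1 and have valuation 0.\<close>
  have "\<mu> \<le> 0" "\<nu> \<le> 0"
    using i0(2)[of "degree q"] j0(2)[of "degree g"] assms(1,2)
    by (auto simp: \<mu>_def \<nu>_def val_ge_def)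
  have "\<mu> + \<nu> \<ge> 0"
  proof (rule ccontr)
    assume neg: "\<not> \<mu> + \<nu> \<ge> 0"
    let ?t = "\<lambda>i. coeff q i * coeff g (i0 + j0 - i)"
    \<comment> \<open>For \<open>i\<close> other than \<open>i0\<close>, either \<open>i\<close>
      exceeds \<open>i0\<close> or the complementary index exceeds \<open>j0\<close>; that factor
      contributes the extra 1.\<close>
    have "val_ge v (\<mu> + \<nu> + 1) (?t i)" if "i \<in> {..i0 + j0} - {i0}" for i
    proof (cases "i0 < i")
      case True
      then show ?thesis
        using val_ge_mult[OF i0(3)[OF True] j0(2)[of "i0 + j0 - i"]]
        by (simp add: \<mu>_def \<nu>_def algebra_simps)
    next
      case False
      then have "j0 < i0 + j0 - i"
        using that by auto
      from val_ge_mult[OF i0(2)[of i] j0(3)[OF this]] show ?thesis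
        by (simp add: \<mu>_def \<nu>_def algebra_simps)
    qed
    then have rest: "val_ge v (\<mu> + \<nu> + 1) (\<Sum>i\<in>{..i0 + j0} - {i0}. ?t i)"
      by (rule val_ge_sum)
    have "coeff (q * g) (i0 + j0) = ?t i0 + (\<Sum>i\<in>{..i0 + j0} - {i0}. ?t i)"
      unfolding coeff_mult by (rule sum.remove) auto
    then have "coeff q i0 * coeff g j0 =
        coeff (q * g) (i0 + j0) - (\<Sum>i\<in>{..i0 + j0} - {i0}. ?t i)"
      by simp
    \<comment> \<open>Valuations are integers, so a negative \<open>\<mu> + \<nu>\<close> gives
      \<open>\<mu> + \<nu> + 1 \<le> 0\<close>.\<close>
    moreover have "val_ge v (\<mu> + \<nu> + 1) (coeff (q * g) (i0 + j0))"
      using int[of "i0 + j0"] neg by (auto simp: val_ring_def intro: val_ge_mono)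
    ultimately have "val_ge v (\<mu> + \<nu> + 1) (coeff q i0 * coeff g j0)"
      using rest by (simp add: val_ge_diff)
    then show False
      using i0(1) j0(1) by (simp add: val_ge_def val_mult \<mu>_def \<nu>_def)
  qed
  then have "\<nu> = 0"
    using \<open>\<mu> \<le> 0\<close> \<open>\<nu> \<le> 0\<close> by linarith
  then show ?thesis
    using j0(2)[of i] by (simp add: val_ring_def \<nu>_def)
qed

end

section \<open>Quadratic algebras in coordinates\<close>

context reduced_quadratic_algebra
begin

text \<open>The structure map of the algebra; it turns scaling into ring multiplication, open to
  ring normalization.\<close>

abbreviation emb :: "'k \<Rightarrow> 'l" where
  "emb c \<equiv> scale c 1"

lemma scale_eq_emb_mult: "scale c x = emb c * x"
  by (simp add: scale_mult)

lemma emb_add: "emb (a + b) = emb a + emb b"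
  and emb_diff: "emb (a - b) = emb a - emb b"
  and emb_uminus: "emb (- a) = - emb a"
  by (simp_all add: scale_left_distrib scale_left_diff_distrib)

lemma emb_mult: "emb (a * b) = emb a * emb b"
  by (simp add: scale_mult)

lemma emb_sum: "emb (sum f S) = (\<Sum>i\<in>S. emb (f i))"
  by (rule scale_sum_left)

text \<open>Nonzero scalars stay nonzero in the algebra, so mapping the coefficients keeps the
  degree and evaluation becomes that of an ordinary polynomial.\<close>

lemma alg_eval_eq_poly: "alg_eval scale f x = poly (map_poly emb f) x"
  by (simp add: alg_eval_def poly_altdef degree_map_poly coeff_map_poly scale_mult)

lemma alg_eval_0 [simp]: "alg_eval scale 0 x = 0"
  by (simp add: alg_eval_eq_poly)

lemma alg_eval_pCons [simp]: "alg_eval scale (pCons c f) x = emb c + x * alg_eval scale f x"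
  by (simp add: alg_eval_eq_poly map_poly_pCons)

lemma alg_eval_add: "alg_eval scale (f + g) x = alg_eval scale f x + alg_eval scale g x"
proof -
  have "map_poly emb (f + g) = map_poly emb f + map_poly emb g"
    by (rule poly_eqI) (simp add: coeff_map_poly emb_add)
  then show ?thesis
    by (simp add: alg_eval_eq_poly)
qed

lemma alg_eval_mult: "alg_eval scale (f * g) x = alg_eval scale f x * alg_eval scale g x"
proof -
  have "map_poly emb (f * g) = map_poly emb f * map_poly emb g"
    by (rule poly_eqI) (simp add: coeff_map_poly coeff_mult emb_sum emb_mult)
  then show ?thesis
    by (simp add: alg_eval_eq_poly)
qed

lemma exists_not_in_range_emb: "\<exists>x. x \<notin> range emb"
proof (rule ccontr)
  assume "\<not> (\<exists>x. x \<notin> range emb)"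
  then have "UNIV \<subseteq> span {1}"
    by (auto simp: span_singleton)
  from dim_le_card[OF this] dim_two show False
    by simp
qed

text \<open>In dimension two, \<open>x * x\<close> has to depend on the independent elements
  \<open>x\<close> and \<open>1\<close>.\<close>

lemma quadratic_relation:
  assumes "x \<notin> range emb"
  obtains a b where "x * x = emb a * x + emb b"
proof -
  obtain B where B: "B \<subseteq> UNIV" "independent B" "UNIV \<subseteq> span B" "card B = 2"
    using basis_exists[of UNIV] dim_two by metis
  then have "finite B"
    by (auto intro: card_ge_0_finite)
  have ind: "independent {x, 1}"
    using assms by (intro independent_insertI) (auto simp: span_singleton independent_empty)
  have "x * x \<in> span {x, 1}"
  proof (rule ccontr)
    assume not: "x * x \<notin> span {x, 1}"
    then have "independent {x * x, x, 1}"
      using ind by (rule independent_insertI)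
    then have "card {x * x, x, 1} \<le> 2"
      using independent_span_bound[OF \<open>finite B\<close>, of "{x * x, x, 1}"] B by auto
    \<comment> \<open>Distinctness makes the cardinality 3; a coincidence would put
      \<open>x * x\<close> into the span or \<open>x\<close> among the scalars.\<close>
    moreover have "x * x \<noteq> x" "x * x \<noteq> 1" "x \<noteq> 1"
      using not assms span_base[of x "{x, 1}"] span_base[of 1 "{x, 1}"]
        range_eqI[of x emb 1] by auto
    ultimately show False
      by simp
  qed
  then obtain a b where "x * x - scale a x = emb b"
    by (auto simp: span_insert span_singleton)
  then have "x * x = emb a * x + emb b"
    by (simp add: scale_eq_emb_mult[of a x] algebra_simps)
  then show thesis
    by (rule that)
qed

text \<open>A nonzero difference of the \<open>x\<close>-coordinates could be inverted, which would
  make \<open>x\<close> a scalar.\<close>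

lemma emb_coords_eq_iff:
  assumes "x \<notin> range emb"
  shows "emb c + emb e * x = emb c' + emb e' * x \<longleftrightarrow> c = c' \<and> e = e'"
proof
  assume "emb c + emb e * x = emb c' + emb e' * x"
  then have eq: "emb (e - e') * x = emb (c' - c)"
    by (simp add: emb_diff algebra_simps)
  have "e - e' = 0"
  proof (rule ccontr)
    assume "e - e' \<noteq> 0"
    then have "x = emb (inverse (e - e')) * (emb (e - e') * x)"
      by (simp add: scale_mult)
    also have "\<dots> = emb (inverse (e - e') * (c' - c))"
      unfolding eq by (simp add: scale_mult)
    finally show False
      using assms by blast
  qed
  with eq show "c = c' \<and> e = e'"
    by auto
qed simp

lemma adjoin_quadratic:
  assumes "0 \<in> A" "1 \<in> A"
    and add: "\<And>x y. x \<in> A \<Longrightarrow> y \<in> A \<Longrightarrow> x + y \<in> A"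
    and mult: "\<And>x y. x \<in> A \<Longrightarrow> y \<in> A \<Longrightarrow> x * y \<in> A"
    and "a \<in> A" "b \<in> A" and x: "x * x = emb a * x + emb b"
  shows "adjoin scale A x = {emb c + emb e * x | c e. c \<in> A \<and> e \<in> A}"
proof
  have "\<exists>c\<in>A. \<exists>e\<in>A. alg_eval scale f x = emb c + emb e * x" if "\<And>i. coeff f i \<in> A" for f
    using that
  proof (induction f)
    case 0
    show ?case
      using assms(1) by force
  next
    case (pCons k f)
    have "k \<in> A"
      using pCons.prems[of 0] by simp
    have "coeff f i \<in> A" for i
      using pCons.prems[of "Suc i"] by simp
    then obtain c e where ce: "c \<in> A" "e \<in> A" "alg_eval scale f x = emb c + emb e * x"
      using pCons.IH by blast
    \<comment> \<open>Horner step: the relation for \<open>x * x\<close> brings the product back to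
      linear form.\<close>
    have "x * (emb c + emb e * x) = emb c * x + emb e * (x * x)"
      by (simp only: algebra_simps)
    then have "alg_eval scale (pCons k f) x = emb (k + e * b) + emb (c + e * a) * x"
      unfolding alg_eval_pCons ce(3) x by (simp only: emb_add emb_mult algebra_simps)
    moreover have "k + e * b \<in> A" "c + e * a \<in> A"
      using \<open>k \<in> A\<close> ce(1,2) assms(5,6) add mult by auto
    ultimately show ?case
      by blast
  qed
  then show "adjoin scale A x \<subseteq> {emb c + emb e * x | c e. c \<in> A \<and> e \<in> A}"
    by (force simp: adjoin_def)
  show "{emb c + emb e * x | c e. c \<in> A \<and> e \<in> A} \<subseteq> adjoin scale A x"
  proof clarify
    fix c e assume "c \<in> A" "e \<in> A"
    then have "\<forall>i. coeff [:c, e:] i \<in> A"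
      using assms(1) by (auto simp: coeff_pCons split: nat.split)
    moreover have "emb c + emb e * x = alg_eval scale [:c, e:] x"
      by (simp add: mult.commute)
    ultimately show "emb c + emb e * x \<in> adjoin scale A x"
      unfolding adjoin_def by blast
  qed
qed

end

section \<open>The orders of a local quadratic algebra\<close>

text \<open>Collects the hypotheses on the field, the algebra, \<open>p\<close> and
  \<open>\<Delta>\<close>; the systems of representatives enter only in individual
  statements.\<close>

locale local_quadratic_order =
  nonarch_local_field_char_0 v + reduced_quadratic_algebra scale
  for v :: "'k::field_char_0 \<Rightarrow> int" and scale :: "'k \<Rightarrow> 'l::comm_ring_1 \<Rightarrow> 'l" +
  fixes p :: 'k and \<Delta> :: 'l
  assumes p_uniformizer: "uniformizer v p"
    and integral_closure_eq: "integral_closure scale (val_ring v) = adjoin scale (val_ring v) \<Delta>"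
begin

abbreviation order :: "nat \<Rightarrow> 'l set" where
  "order \<equiv> quad_order v scale p \<Delta>"

lemma p_nonzero [simp]: "p \<noteq> 0"
  and val_p: "v p = 1"
  using p_uniformizer by (auto simp: uniformizer_def)

lemma p_in_val_ring: "p \<in> val_ring v"
  by (simp add: val_ring_def val_ge_def val_p)

lemma val_p_power: "v (p ^ n) = int n"
  by (induction n) (simp_all add: val_mult val_p)

lemma p_power_in_val_ideal: "1 \<le> k \<Longrightarrow> p ^ k \<in> val_ideal v"
  by (simp add: val_ideal_def val_ge_def val_p_power)

lemma val_ideal_eq: "val_ideal v = (\<lambda>x. p * x) ` val_ring v"
proof
  show "val_ideal v \<subseteq> (\<lambda>x. p * x) ` val_ring v"
  proof
    fix x assume x: "x \<in> val_ideal v"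
    have "x / p \<in> val_ring v"
    proof (cases "x = 0")
      case False
      then show ?thesis
        using x by (simp add: val_ideal_def val_ring_def val_ge_def divide_inverse val_mult
            val_inverse val_p)
    qed (simp add: zero_in_val_ring)
    then show "x \<in> (\<lambda>x. p * x) ` val_ring v"
      by (intro image_eqI[of _ _ "x / p"]) auto
  qed
  show "(\<lambda>x. p * x) ` val_ring v \<subseteq> val_ideal v"
    using mult_in_val_ideal[of p] p_power_in_val_ideal[of 1] by auto
qed

lemma p_power_mult_in_val_ring:
  obtains m where "p ^ m * x \<in> val_ring v"
proof (cases "x = 0")
  case False
  then have "p ^ nat (- v x) * x \<in> val_ring v"
    by (simp add: val_ring_def val_ge_def val_mult val_p_power)
  then show thesis
    by (rule that)
qed (use that zero_in_val_ring in auto)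

section \<open>The integral quadratic equation of \<open>\<Delta>\<close>\<close>

lemma quadratic_in_integral_closure:
  assumes "a \<in> val_ring v" "b \<in> val_ring v" and x: "x * x = emb a * x + emb b"
  shows "x \<in> integral_closure scale (val_ring v)"
proof -
  have "\<forall>i. coeff [:- b, - a, 1:] i \<in> val_ring v"
    using assms(1,2) by (auto simp: coeff_pCons val_ring_intros split: nat.split)
  moreover have "alg_eval scale [:- b, - a, 1:] x = x * x - (emb a * x + emb b)"
    by (simp add: emb_uminus algebra_simps)
  ultimately show ?thesis
    unfolding integral_closure_def using x by (intro CollectI exI[of _ "[:- b, - a, 1:]"]) auto
qed

lemma Delta_notin_range_emb: "\<Delta> \<notin> range emb"
  \<comment> \<open>Every element of the algebra becomes integral after scaling by a power of \<open>p\<close>, so the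
    integral closure is not contained in the scalars.\<close>
proof
  assume "\<Delta> \<in> range emb"
  then obtain k where k: "\<Delta> = emb k"
    by blast
  have "alg_eval scale f \<Delta> \<in> range emb" for f
  proof (induction f)
    case (pCons c f)
    then obtain l where "alg_eval scale f \<Delta> = emb l"
      by blast
    then have "alg_eval scale (pCons c f) \<Delta> = emb (c + k * l)"
      unfolding alg_eval_pCons k by (simp only: emb_add emb_mult)
    then show ?case
      by blast
  qed (auto intro: range_eqI[of _ _ 0])
  then have range: "integral_closure scale (val_ring v) \<subseteq> range emb"
    unfolding integral_closure_eq adjoin_def by blast
  obtain x where x: "x \<notin> range emb"
    using exists_not_in_range_emb by blast
  obtain a b where ab: "x * x = emb a * x + emb b"
    using quadratic_relation[OF x] by blast
  obtain i j where ij: "p ^ i * a \<in> val_ring v" "p ^ j * b \<in> val_ring v"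
    using p_power_mult_in_val_ring by metis
  \<comment> \<open>Scaling \<open>x\<close> by \<open>q\<close> turns the coefficients
    \<open>a\<close> and \<open>b\<close> into \<open>q * a\<close> and \<open>q * q * b\<close>, so
    this one factor clears both denominators.\<close>
  define q where "q = p ^ i * p ^ j"
  have "q * a = p ^ j * (p ^ i * a)" "q * q * b = p ^ i * p ^ i * p ^ j * (p ^ j * b)"
    by (simp_all add: q_def ac_simps)
  then have "q * a \<in> val_ring v" "q * q * b \<in> val_ring v"
    using ij p_in_val_ring by (simp_all only: val_ring_intros)
  moreover have "(emb q * x) * (emb q * x) = emb (q * a) * (emb q * x) + emb (q * q * b)"
  proof -
    have "(emb q * x) * (emb q * x) = emb q * emb q * (x * x)"
      by (simp only: ac_simps)
    then show ?thesis
      unfolding ab emb_mult by (simp only: algebra_simps)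
  qed
  ultimately have "emb q * x \<in> integral_closure scale (val_ring v)"
    by (rule quadratic_in_integral_closure)
  then obtain e where "emb q * x = emb e"
    using range by blast
  then have "emb (inverse q) * (emb q * x) = emb (inverse q * e)"
    by (simp only: emb_mult)
  moreover have "q \<noteq> 0"
    by (simp add: q_def)
  ultimately have "x = emb (inverse q * e)"
    by (simp add: scale_mult)
  then show False
    using x by blast
qed

text \<open>The quadratic polynomial \<open>g\<close> of \<open>\<Delta>\<close> over the field
  divides any monic integral \<open>f\<close> killing \<open>\<Delta>\<close>, as the remainder has
  degree below 2 and 1, \<open>\<Delta>\<close> are independent. Gauss's lemma then makes
  \<open>g\<close> integral.\<close>

lemma Delta_quadratic:
  obtains a b where "a \<in> val_ring v" "b \<in> val_ring v" "\<Delta> * \<Delta> = emb a * \<Delta> + emb b"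
proof -
  obtain a b where ab: "\<Delta> * \<Delta> = emb a * \<Delta> + emb b"
    using quadratic_relation[OF Delta_notin_range_emb] by blast
  define g where "g = [:- b, - a, 1:]"
  have g: "lead_coeff g = 1" "degree g = 2" "alg_eval scale g \<Delta> = 0"
    using ab by (simp_all add: g_def emb_uminus algebra_simps)
  \<comment> \<open>The polynomial X shows that \<open>\<Delta>\<close> lies in the ring it
    generates, hence is integral.\<close>
  have "\<forall>i. coeff [:0, 1:] i \<in> val_ring v"
    by (auto simp: coeff_pCons val_ring_intros split: nat.split)
  moreover have "alg_eval scale [:0, 1:] \<Delta> = \<Delta>"
    by simp
  ultimately have "\<Delta> \<in> integral_closure scale (val_ring v)"
    unfolding integral_closure_eq adjoin_def
    by (intro CollectI exI[of _ "[:0, 1:]"] conjI) simp_all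
  then obtain f where f: "lead_coeff f = 1" "\<And>i. coeff f i \<in> val_ring v"
    "alg_eval scale f \<Delta> = 0"
    unfolding integral_closure_def by blast
  define r where "r = f mod g"
  have fg: "f = f div g * g + r"
    by (simp add: r_def)
  have "alg_eval scale r \<Delta> = 0"
    using f(3) g(3) alg_eval_add[of "f div g * g" r \<Delta>] fg by (simp add: alg_eval_mult)
  have "g \<noteq> 0"
    using g(1) by auto
  then have "degree r < 2"
    using degree_mod_less[of g f] g(2) by (auto simp: r_def)
  then have r: "r = [:coeff r 0, coeff r 1:]"
    by (intro poly_eqI) (auto simp: coeff_pCons coeff_eq_0 split: nat.split)
  have "alg_eval scale r \<Delta> = emb (coeff r 0) + emb (coeff r 1) * \<Delta>"
    by (subst r) (simp add: mult.commute)
  with \<open>alg_eval scale r \<Delta> = 0\<close> have "coeff r 0 = 0 \<and> coeff r 1 = 0"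
    using emb_coords_eq_iff[OF Delta_notin_range_emb, of "coeff r 0" "coeff r 1" 0 0] by simp
  with r have "r = 0"
    by simp
  with fg have fg: "f = f div g * g"
    by simp
  have "lead_coeff (f div g) = 1"
    using f(1) g(1) lead_coeff_mult[of "f div g" g] fg by simp
  then have "coeff g i \<in> val_ring v" for i
    using monic_factor_coeff_in_val_ring[of "f div g" g i] g(1) f(2) fg by simp
  from this[of 0] this[of 1] have "- b \<in> val_ring v" "- a \<in> val_ring v"
    by (simp_all add: g_def)
  then have "a \<in> val_ring v" "b \<in> val_ring v"
    using uminus_in_val_ring by fastforce+
  then show thesis
    using ab by (rule that)
qed

text \<open>The generator \<open>p ^ n * \<Delta>\<close> satisfies its own integral quadratic
  equation, with coefficients \<open>p ^ n * a\<close> and \<open>p ^ n * p ^ n * b\<close>.\<close>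

lemma order_eq:
  "order n = {emb c + emb (e * p ^ n) * \<Delta> | c e. c \<in> val_ring v \<and> e \<in> val_ring v}"
proof -
  obtain a b where ab: "a \<in> val_ring v" "b \<in> val_ring v" "\<Delta> * \<Delta> = emb a * \<Delta> + emb b"
    by (rule Delta_quadratic)
  let ?x = "emb (p ^ n) * \<Delta>"
  have "?x * ?x = emb (p ^ n) * emb (p ^ n) * (\<Delta> * \<Delta>)"
    by (simp only: ac_simps)
  then have x: "?x * ?x = emb (p ^ n * a) * ?x + emb (p ^ n * p ^ n * b)"
    unfolding ab(3) emb_mult by (simp only: algebra_simps)
  have "order n = adjoin scale (val_ring v) ?x"
    by (simp add: quad_order_def scale_mult)
  also have "\<dots> = {emb c + emb e * ?x | c e. c \<in> val_ring v \<and> e \<in> val_ring v}"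
    by (rule adjoin_quadratic[OF _ _ _ _ _ _ x])
      (use ab(1,2) p_in_val_ring in \<open>simp_all only: val_ring_intros\<close>)
  finally show ?thesis
    by (simp add: scale_mult)
qed

section \<open>Products and units in coordinates\<close>

lemma mult_coords:
  assumes "\<Delta> * \<Delta> = emb a * \<Delta> + emb b"
  shows "(emb c + emb e * \<Delta>) * (emb c' + emb e' * \<Delta>) =
    emb (c * c' + e * e' * b) + emb (c * e' + e * c' + e * e' * a) * \<Delta>"
proof -
  have "(emb c + emb e * \<Delta>) * (emb c' + emb e' * \<Delta>) =
      emb c * emb c' + (emb c * emb e' + emb e * emb c') * \<Delta> + emb e * emb e' * (\<Delta> * \<Delta>)"
    by (simp only: algebra_simps)
  then show ?thesis
    unfolding assms emb_add emb_mult by (simp only: algebra_simps)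
qed

lemma monoid_order: "monoid (mult_monoid (order n))"
  unfolding monoid_mult_monoid_iff
proof (intro conjI ballI)
  show "1 \<in> order n"
    unfolding order_eq using zero_in_val_ring one_in_val_ring
    by (intro CollectI exI[of _ 1] exI[of _ 0]) simp
  fix x y assume "x \<in> order n" "y \<in> order n"
  then obtain c e c' e' where
    O: "c \<in> val_ring v" "e \<in> val_ring v" "c' \<in> val_ring v" "e' \<in> val_ring v"
    and xy: "x = emb c + emb (e * p ^ n) * \<Delta>" "y = emb c' + emb (e' * p ^ n) * \<Delta>"
    unfolding order_eq by blast
  obtain a b where ab: "a \<in> val_ring v" "b \<in> val_ring v" "\<Delta> * \<Delta> = emb a * \<Delta> + emb b"
    by (rule Delta_quadratic)
  have "x * y = emb (c * c' + (e * p ^ n) * (e' * p ^ n) * b) +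
      emb ((c * e' + e * c' + e * e' * p ^ n * a) * p ^ n) * \<Delta>"
    unfolding xy mult_coords[OF ab(3)] by (simp only: algebra_simps)
  moreover have "c * c' + (e * p ^ n) * (e' * p ^ n) * b \<in> val_ring v"
    "c * e' + e * c' + e * e' * p ^ n * a \<in> val_ring v"
    using O ab(1,2) p_in_val_ring by (simp_all only: val_ring_intros)
  ultimately show "x * y \<in> order n"
    unfolding order_eq by blast
qed

lemma order_antimono: "i \<le> j \<Longrightarrow> order j \<subseteq> order i"
proof
  fix x assume "i \<le> j" "x \<in> order j"
  then obtain c e where ce: "c \<in> val_ring v" "e \<in> val_ring v" "x = emb c + emb (e * p ^ j) * \<Delta>"
    unfolding order_eq by blast
  have "x = emb c + emb (e * p ^ (j - i) * p ^ i) * \<Delta>"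
    using \<open>i \<le> j\<close> ce(3) by (simp add: mult.assoc flip: power_add)
  moreover have "e * p ^ (j - i) \<in> val_ring v"
    using ce(2) p_in_val_ring by (simp only: val_ring_intros)
  ultimately show "x \<in> order i"
    unfolding order_eq using ce(1) by blast
qed

text \<open>As \<open>p ^ k\<close> lies in the maximal ideal, constant coordinates multiply modulo
  that ideal, which makes \<open>c\<close> a unit if the element is one. Conversely, the norm is
  congruent to \<open>c * c\<close>, hence invertible.\<close>

lemma Units_order_iff:
  assumes "1 \<le> k" and O: "c \<in> val_ring v" "e \<in> val_ring v"
  shows "emb c + emb (e * p ^ k) * \<Delta> \<in> Units (mult_monoid (order k)) \<longleftrightarrow> c \<notin> val_ideal v"
    (is "?x \<in> _ \<longleftrightarrow> _")
proof
  obtain a b where ab: "a \<in> val_ring v" "b \<in> val_ring v" "\<Delta> * \<Delta> = emb a * \<Delta> + emb b"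
    by (rule Delta_quadratic)
  note pk = p_power_in_val_ideal[OF \<open>1 \<le> k\<close>]
  {
    assume "?x \<in> Units (mult_monoid (order k))"
    then obtain c' e' where O': "c' \<in> val_ring v" "e' \<in> val_ring v"
      and "?x * (emb c' + emb (e' * p ^ k) * \<Delta>) = 1"
      unfolding Units_mult_monoid order_eq by blast
    then have eq: "c * c' + e * p ^ k * (e' * p ^ k) * b = 1"
      unfolding mult_coords[OF ab(3)]
      using emb_coords_eq_iff[OF Delta_notin_range_emb, where c' = 1 and e' = 0] by simp
    have "p ^ k * (e * (e' * p ^ k) * b) \<in> val_ideal v"
      by (rule mult_in_val_ideal[OF pk])
        (use O O' ab p_in_val_ring in \<open>simp only: val_ring_intros\<close>)
    then have small: "e * p ^ k * (e' * p ^ k) * b \<in> val_ideal v"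
      by (simp add: ac_simps)
    show "c \<notin> val_ideal v"
    proof
      assume "c \<in> val_ideal v"
      then have "c * c' \<in> val_ideal v"
        using O' by (simp add: mult_in_val_ideal)
      then show False
        using add_in_val_ideal[OF _ small] one_notin_val_ideal eq by metis
    qed
  next
    assume c: "c \<notin> val_ideal v"
    \<comment> \<open>the norm of the element\<close>
    define N where "N = c * c + (c * e * p ^ k * a - e * e * p ^ k * p ^ k * b)"
    have "p ^ k * (c * e * a - e * e * p ^ k * b) \<in> val_ideal v"
      by (rule mult_in_val_ideal[OF pk])
        (use O ab p_in_val_ring in \<open>simp only: val_ring_intros\<close>)
    then have "c * e * p ^ k * a - e * e * p ^ k * p ^ k * b \<in> val_ideal v"
      by (simp add: algebra_simps)
    then have "N \<notin> val_ideal v"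
      using c O by (simp add: N_def add_in_val_ideal_iff mult_in_val_ideal_iff)
    moreover have "N \<in> val_ring v"
      unfolding N_def using O ab p_in_val_ring by (simp only: val_ring_intros)
    ultimately have N: "inverse N \<in> val_ring v" "N \<noteq> 0"
      using inverse_in_val_ring zero_in_val_ideal by auto
    \<comment> \<open>Coordinates of the conjugate divided by the norm; conjugation sends
      \<open>\<Delta>\<close> to \<open>a - \<Delta>\<close>.\<close>
    define c' e' where "c' = (c + e * p ^ k * a) * inverse N" and "e' = - e * inverse N"
    have O': "c' \<in> val_ring v" "e' \<in> val_ring v"
      unfolding c'_def e'_def using O ab p_in_val_ring N(1) by (simp_all only: val_ring_intros)
    have "c * c' + e * p ^ k * (e' * p ^ k) * b = N * inverse N"
      by (simp add: c'_def e'_def N_def algebra_simps)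
    moreover have "c * (e' * p ^ k) + e * p ^ k * c' + e * p ^ k * (e' * p ^ k) * a = 0"
      by (simp add: c'_def e'_def algebra_simps)
    ultimately have "?x * (emb c' + emb (e' * p ^ k) * \<Delta>) = 1"
      unfolding mult_coords[OF ab(3)] using N(2) by simp
    then show "?x \<in> Units (mult_monoid (order k))"
      unfolding Units_mult_monoid order_eq using O O' by blast
  }
qed

text \<open>Restates the residue cosets as congruence classes modulo the maximal ideal.\<close>

lemma represents_val_ring_mod_iff:
  "represents (\<lambda>t. t) R (rcosets\<^bsub>additive_group (val_ring v)\<^esub> ((\<lambda>x. p * x) ` val_ring v)) \<longleftrightarrow>
    R \<subseteq> val_ring v \<and> (\<forall>x\<in>val_ring v. \<exists>!t. t \<in> R \<and> t - x \<in> val_ideal v)"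
proof -
  have cosets: "rcosets\<^bsub>additive_group (val_ring v)\<^esub> ((\<lambda>x. p * x) ` val_ring v) =
      (\<lambda>x. {t. t - x \<in> val_ideal v}) ` val_ring v"
  proof -
    have "(\<Union>h\<in>val_ideal v. {h + x}) = {t. t - x \<in> val_ideal v}" for x
      by (auto intro: bexI[of _ "_ - x"])
    then show ?thesis
      unfolding val_ideal_eq[symmetric] RCOSETS_def r_coset_def
      by (auto simp: additive_group_def)
  qed
  have "{t. t - x \<in> val_ideal v} \<subseteq> val_ring v" if "x \<in> val_ring v" for x
    using that val_ideal_subset add_in_val_ring[of _ x] by force
  moreover have "x \<in> {t. t - x \<in> val_ideal v}" for x
    by (simp add: zero_in_val_ideal)
  ultimately have "\<Union> ((\<lambda>x. {t. t - x \<in> val_ideal v}) ` val_ring v) = val_ring v"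
    by blast
  then show ?thesis
    by (simp add: represents_def cosets)
qed

text \<open>Lying in the coset of \<open>x\<close> becomes a linear congruence in \<open>t\<close>
  whose leading coefficient is a unit, so one residue class solves it.\<close>

lemma represents_unit_cosets_order_Suc:
  assumes "1 \<le> i"
    and R: "represents (\<lambda>t. t) R
      (rcosets\<^bsub>additive_group (val_ring v)\<^esub> ((\<lambda>x. p * x) ` val_ring v))"
  shows "represents (\<lambda>t. 1 + scale (t * p ^ i) \<Delta>) R (unit_cosets (order i) (order (Suc i)))"
proof -
  have RO: "R \<subseteq> val_ring v" and
    R_ex1: "\<And>x. x \<in> val_ring v \<Longrightarrow> \<exists>!t. t \<in> R \<and> t - x \<in> val_ideal v"
    using R unfolding represents_val_ring_mod_iff by blast+
  obtain a b where ab: "a \<in> val_ring v" "b \<in> val_ring v" "\<Delta> * \<Delta> = emb a * \<Delta> + emb b"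
    by (rule Delta_quadratic)
  have u: "1 + scale (t * p ^ i) \<Delta> = emb 1 + emb (t * p ^ i) * \<Delta>" for t
    by (simp add: scale_mult)
  have "\<exists>!t. t \<in> R \<and> (\<exists>h\<in>Units (mult_monoid (order (Suc i))). 1 + scale (t * p ^ i) \<Delta> = h * x)"
    if x: "x \<in> Units (mult_monoid (order i))" for x
  proof -
    obtain y where y: "y \<in> Units (mult_monoid (order i))" "x * y = 1"
      using Units_mult_monoid_inverseE[OF x] by blast
    then obtain c e where ce: "c \<in> val_ring v" "e \<in> val_ring v" "y = emb c + emb (e * p ^ i) * \<Delta>"
      unfolding Units_mult_monoid order_eq by blast
    have c: "c \<notin> val_ideal v"
      using y(1) Units_order_iff[OF \<open>1 \<le> i\<close> ce(1,2)] ce(3) by simp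
    then have "c \<noteq> 0"
      using zero_in_val_ideal by auto
    have coset_iff: "(\<exists>h\<in>Units (mult_monoid (order (Suc i))). 1 + scale (t * p ^ i) \<Delta> = h * x) \<longleftrightarrow>
        t * c + e \<in> val_ideal v" if t: "t \<in> val_ring v" for t
    proof -
      \<comment> \<open>The constant coordinate of the product with \<open>y\<close>;
        \<open>s\<close> is the part of the other coordinate that comes from the square of
        \<open>\<Delta>\<close>. Since \<open>i\<close> is positive, both corrections are divisible
        by \<open>p\<close>.\<close>
      define c' where "c' = c + t * e * p ^ i * p ^ i * b"
      define s where "s = p ^ i * (t * e * a)"
      have s: "s \<in> val_ideal v"
        unfolding s_def using t ce ab
        by (intro mult_in_val_ideal p_power_in_val_ideal \<open>1 \<le> i\<close>) (simp_all only: val_ring_intros)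
      have uy: "(1 + scale (t * p ^ i) \<Delta>) * y = emb c' + emb ((t * c + e + s) * p ^ i) * \<Delta>"
        unfolding u ce(3) mult_coords[OF ab(3)] by (simp add: c'_def s_def algebra_simps)
      have "(\<exists>h\<in>Units (mult_monoid (order (Suc i))). 1 + scale (t * p ^ i) \<Delta> = h * x) \<longleftrightarrow>
          (1 + scale (t * p ^ i) \<Delta>) * y \<in> Units (mult_monoid (order (Suc i)))"
        (is "(\<exists>h\<in>_. ?u = h * x) \<longleftrightarrow> _")
      proof -
        have "?u = h * x \<longleftrightarrow> h = ?u * y" for h
          using y(2) by (metis mult.assoc mult.commute mult_1)
        then show ?thesis
          by auto
      qed
      also have "\<dots> \<longleftrightarrow> t * c + e + s \<in> val_ideal v"
        unfolding uy
      proof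
        assume "emb c' + emb ((t * c + e + s) * p ^ i) * \<Delta> \<in> Units (mult_monoid (order (Suc i)))"
        then obtain c'' e'' where "e'' \<in> val_ring v"
          "emb c' + emb ((t * c + e + s) * p ^ i) * \<Delta> = emb c'' + emb (e'' * p ^ Suc i) * \<Delta>"
          unfolding Units_mult_monoid order_eq by blast
        then have "(t * c + e + s) * p ^ i = (p * e'') * p ^ i"
          unfolding emb_coords_eq_iff[OF Delta_notin_range_emb] by (simp add: ac_simps)
        then have "t * c + e + s = p * e''"
          by simp
        then show "t * c + e + s \<in> val_ideal v"
          unfolding val_ideal_eq using \<open>e'' \<in> val_ring v\<close> by blast
      next
        assume "t * c + e + s \<in> val_ideal v"
        then obtain e'' where e'': "e'' \<in> val_ring v" "t * c + e + s = p * e''"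
          unfolding val_ideal_eq by blast
        \<comment> \<open>This makes \<open>c'\<close> congruent to \<open>c\<close>, hence a unit,
          as the unit criterion at level \<open>Suc i\<close> demands.\<close>
        have "p ^ i * (t * e * p ^ i * b) \<in> val_ideal v"
          using t ce ab p_in_val_ring
          by (intro mult_in_val_ideal p_power_in_val_ideal \<open>1 \<le> i\<close>) (simp_all only: val_ring_intros)
        then have "t * e * p ^ i * p ^ i * b \<in> val_ideal v"
          by (simp add: ac_simps)
        then have "c' \<notin> val_ideal v"
          using c by (simp add: c'_def add_in_val_ideal_iff)
        moreover have "c' \<in> val_ring v"
          unfolding c'_def using t ce ab p_in_val_ring by (simp only: val_ring_intros)
        ultimately have "emb c' + emb (e'' * p ^ Suc i) * \<Delta> \<in> Units (mult_monoid (order (Suc i)))"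
          using Units_order_iff[of "Suc i" c' e''] e''(1) by simp
        moreover have "(t * c + e + s) * p ^ i = e'' * p ^ Suc i"
          unfolding e''(2) by (simp add: ac_simps)
        ultimately show
          "emb c' + emb ((t * c + e + s) * p ^ i) * \<Delta> \<in> Units (mult_monoid (order (Suc i)))"
          by (simp only:)
      qed
      also have "\<dots> \<longleftrightarrow> t * c + e \<in> val_ideal v"
        by (rule add_in_val_ideal_iff[OF s])
      finally show ?thesis .
    qed
    \<comment> \<open>The root of \<open>t * c + e\<close>, integral because \<open>c\<close> is a
      unit.\<close>
    define z where "z = - e * inverse c"
    have z: "z \<in> val_ring v"
      unfolding z_def using ce(2) inverse_in_val_ring[OF ce(1) c] by (simp only: val_ring_intros)
    have "t * c + e \<in> val_ideal v \<longleftrightarrow> t - z \<in> val_ideal v" if "t \<in> val_ring v" for t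
    proof -
      have "t * c + e = (t - z) * c"
        using \<open>c \<noteq> 0\<close> by (simp add: z_def algebra_simps)
      then show ?thesis
        using mult_in_val_ideal_iff[of "t - z" c] that z ce(1) c by (simp add: diff_in_val_ring)
    qed
    with coset_iff RO have "t \<in> R \<and>
        (\<exists>h\<in>Units (mult_monoid (order (Suc i))). 1 + scale (t * p ^ i) \<Delta> = h * x) \<longleftrightarrow>
        t \<in> R \<and> t - z \<in> val_ideal v" for t
      by blast
    then show ?thesis
      using R_ex1[OF z] by (simp only:)
  qed
  moreover have "1 + scale (t * p ^ i) \<Delta> \<in> Units (mult_monoid (order i))" if "t \<in> R" for t
    unfolding u using Units_order_iff[OF \<open>1 \<le> i\<close> one_in_val_ring] one_notin_val_ideal that RO
    by blast
  ultimately show ?thesis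
    unfolding represents_unit_cosets_iff[OF monoid_order monoid_order
        order_antimono[OF le_SucI[OF le_refl]]]
    by blast
qed

end

theorem theorem5p9:
  fixes v :: "'k::field_char_0 \<Rightarrow> int"
    and scale :: "'k \<Rightarrow> 'l::comm_ring_1 \<Rightarrow> 'l"
    and p :: 'k and \<Delta> :: 'l and R :: "'k set" and u0 :: "nat \<Rightarrow> 'l" and n d :: nat
  assumes "nonarch_local_field_char_0 v"
    and "uniformizer v p"
    and "reduced_quadratic_algebra scale"
    and "integral_closure scale (val_ring v) = adjoin scale (val_ring v) \<Delta>"
    and "R \<subseteq> val_ring v"
    and "represents (\<lambda>t. t) R
      (rcosets\<^bsub>additive_group (val_ring v)\<^esub> ((\<lambda>x. p * x) ` val_ring v))"
    and "represents u0 (R0 v scale p \<Delta>)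
      (unit_cosets (quad_order v scale p \<Delta> 0) (quad_order v scale p \<Delta> 1))"
    and "d \<le> n"
  shows "represents (u_tuple scale p \<Delta> u0 d n) (index_tuples (R0 v scale p \<Delta>) R d n)
    (unit_cosets (quad_order v scale p \<Delta> (n - d)) (quad_order v scale p \<Delta> n))"
proof -
  interpret local_quadratic_order v scale p \<Delta>
    using assms(1-4) by (intro local_quadratic_order.intro local_quadratic_order_axioms.intro)
  \<comment> \<open>Level 0 is the hypothesis on \<open>u0\<close>; positive levels follow from the
    congruence argument.\<close>
  have "represents (u_factor scale p \<Delta> u0 i)
      (if i = 0 then Inl ` R0 v scale p \<Delta> else Inr ` R)
      (unit_cosets (order i) (order (Suc i)))" for i
  proof (cases "i = 0")
    case True
    then show ?thesis
      using assms(7) by (simp add: represents_image_iff u_factor_def)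
  next
    case False
    then show ?thesis
      using represents_unit_cosets_order_Suc[OF _ assms(6), of i]
      by (simp add: represents_image_iff u_factor_def)
  qed
  \<comment> \<open>The chain of orders runs from level \<open>n - d\<close> up to level
    \<open>n\<close>.\<close>
  then show ?thesis
    unfolding u_tuple_def index_tuples_def
    by (intro represents_unit_cosets_chain monoid_order order_antimono) simp_all
qed

end
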